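(* For every integer $N \geq 2$ there exist a positive integer $n$, a nonempty closed convex set $C \subset \mathbb{R}^n$, bifunctions $f_1, \dots, f_N : C \times C \to \mathbb{R}$, each satisfying conditions $(\mathcal{A}_1)$–$(\mathcal{A}_4)$ stated in the context, with $\bigcap_{i=1}^N Sol(C, f_i) \neq \emptyset$, and numbers $\alpha_1, \dots, \alpha_N \in (0,1)$ with $\sum_{i=1}^N \alpha_i = 1$, such that $$Sol\Big(C, \sum_{i=1}^N \alpha_i f_i\Big) \not\subset \bigcap_{i=1}^N Sol(C, f_i).$$
   Context: For a nonempty closed convex set $C \subset \mathbb{R}^n$ (Euclidean space) and a bifunction $f : C \times C \to \mathbb{R}$, the solution set of the equilibrium problem is $Sol(C,f) := \{x^* \in C : f(x^*, y) \geq 0 \text{ for all } y \in C\}$. The bifunction $\sum_{i=1}^N \alpha_i f_i$ is defined pointwise by $(x,y) \mapsto \sum_{i=1}^N \alpha_i f_i(x,y)$. Conditions on a bifunction $\varphi : C \times C \to \mathbb{R}$: $(\mathcal{A}_1)$ $\varphi(x,x) = 0$ for every $x \in C$; $(\mathcal{A}_2)$ $\varphi$ is monotone on $C$, i.e. $\varphi(x,y) + \varphi(y,x) \leq 0$ for all $x,y \in C$; $(\mathcal{A}_3)$ $\varphi$ is upper hemicontinuous: for all $x,y,z \in C$, $\limsup_{t \to 0^+} \varphi(tz + (1-t)x, y) \leq \varphi(x,y)$; $(\mathcal{A}_4)$ for each $x \in C$, the function $\varphi(x, \cdot)$ is lower semicontinuous and convex on $C$. *)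

theory Defs
  imports "HOL-Analysis.Analysis"
begin

(* The dimension n is existentially quantified, so R^n is the library's Euclidean_space n,
   whose points are the sequences nat => real with x i = 0 for all i >= n.
   Its topology is the subspace topology of the product topology, i.e. the type class topology
   of nat => real, so that closedin (Euclidean_space n) and at y within C refer to the
   usual topology of R^n.  The type nat => real is not an instance of real_vector, so convex
   combinations are written coordinatewise, and the library's convex and convex_on are not
   available. *)

definition comb :: "real \<Rightarrow> (nat \<Rightarrow> real) \<Rightarrow> (nat \<Rightarrow> real) \<Rightarrow> (nat \<Rightarrow> real)" where
  "comb t x y = (\<lambda>i. t * x i + (1 - t) * y i)"

definition convex_seq :: "(nat \<Rightarrow> real) set \<Rightarrow> bool" where
  "convex_seq C \<longleftrightarrow> (\<forall>x\<in>C. \<forall>y\<in>C. \<forall>t\<in>{0..1}. comb t x y \<in> C)"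

definition convex_seq_on :: "(nat \<Rightarrow> real) set \<Rightarrow> ((nat \<Rightarrow> real) \<Rightarrow> real) \<Rightarrow> bool" where
  "convex_seq_on C g \<longleftrightarrow>
     convex_seq C \<and>
     (\<forall>x\<in>C. \<forall>y\<in>C. \<forall>t\<in>{0..1}. g (comb t x y) \<le> t * g x + (1 - t) * g y)"

(* The limit inferior is over y' in C - {y}; at an isolated point of C it is \<infinity>. *)
definition lsc_on :: "'a::topological_space set \<Rightarrow> ('a \<Rightarrow> real) \<Rightarrow> bool" where
  "lsc_on C g \<longleftrightarrow> (\<forall>y\<in>C. ereal (g y) \<le> Liminf (at y within C) (\<lambda>y'. ereal (g y')))"

(* A bifunction C x C -> R is a curried total function of which only the values on C matter. *)

type_synonym bifun = "(nat \<Rightarrow> real) \<Rightarrow> (nat \<Rightarrow> real) \<Rightarrow> real"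

definition Sol :: "(nat \<Rightarrow> real) set \<Rightarrow> bifun \<Rightarrow> (nat \<Rightarrow> real) set" where
  "Sol C f = {x \<in> C. \<forall>y\<in>C. f x y \<ge> 0}"

definition A1 :: "(nat \<Rightarrow> real) set \<Rightarrow> bifun \<Rightarrow> bool" where
  "A1 C \<phi> \<longleftrightarrow> (\<forall>x\<in>C. \<phi> x x = 0)"

definition A2 :: "(nat \<Rightarrow> real) set \<Rightarrow> bifun \<Rightarrow> bool" where
  "A2 C \<phi> \<longleftrightarrow> (\<forall>x\<in>C. \<forall>y\<in>C. \<phi> x y + \<phi> y x \<le> 0)"

(* For convex C the limit superior only involves values of \<phi> on C x C,
   since comb t z x is in C for 0 < t <= 1; it may be infinite, hence ereal. *)
definition A3 :: "(nat \<Rightarrow> real) set \<Rightarrow> bifun \<Rightarrow> bool" where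
  "A3 C \<phi> \<longleftrightarrow> (\<forall>x\<in>C. \<forall>y\<in>C. \<forall>z\<in>C.
     Limsup (at_right 0) (\<lambda>t. ereal (\<phi> (comb t z x) y)) \<le> ereal (\<phi> x y))"

definition A4 :: "(nat \<Rightarrow> real) set \<Rightarrow> bifun \<Rightarrow> bool" where
  "A4 C \<phi> \<longleftrightarrow> (\<forall>x\<in>C. lsc_on C (\<phi> x) \<and> convex_seq_on C (\<phi> x))"

end

theory Submission
  imports Defs
begin

text \<open>
  The counterexample comes from the rotation of the plane by a right angle. Write \<open>J\<close> for
  this rotation; the bilinear form \<open>\<langle>J x, y\<rangle> = x\<^sub>0 y\<^sub>1 - x\<^sub>1 y\<^sub>0\<close> is alternating, so it is
  a monotone bifunction, and so is its negative: monotonicity holds with equality for both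
  of them. The origin solves both equilibrium problems. With equal weights, however, the
  two forms cancel, so that every point of the plane solves the averaged problem, whereas a nonzero
  \<open>x\<close> does not solve the problem of the form itself, because a nonzero linear functional
  takes negative values. For more than two bifunctions, the remaining ones are zero.

  Monotonicity cannot exclude this. If \<open>x\<close> solves the averaged problem and \<open>p\<close> is a common
  solution, then \<open>f\<^sub>i x p \<le> - f\<^sub>i p x \<le> 0\<close> for every \<open>i\<close>, while the average of the numbers
  \<open>f\<^sub>i x p\<close> is nonnegative, and so each of them is zero. But this concerns only the one
  point \<open>p\<close>: here \<open>p\<close> is the origin, where the forms vanish for every \<open>x\<close>.
\<close>

definition rotation_bifun :: "real \<Rightarrow> bifun" where
  "rotation_bifun c x y = c * (x 0 * y 1 - x 1 * y 0)"

lemma convex_seq_Euclidean_space: "convex_seq (topspace (Euclidean_space n))"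
  by (auto simp: convex_seq_def comb_def topspace_Euclidean_space)

lemma lsc_on_continuous:
  assumes "continuous_on C g"
  shows "lsc_on C g"
  unfolding lsc_on_def
proof
  fix y assume "y \<in> C"
  with assms have lim: "((\<lambda>y'. ereal (g y')) \<longlongrightarrow> ereal (g y)) (at y within C)"
    by (auto simp: continuous_on_def)
  show "ereal (g y) \<le> Liminf (at y within C) (\<lambda>y'. ereal (g y'))"
  proof (cases "at y within C = bot")
    case True
    \<comment> \<open>At an isolated point the limit inferior is over the trivial filter, so it is \<open>\<infinity>\<close>.\<close>
    then show ?thesis by (intro Liminf_bounded) simp
  next
    case False
    then show ?thesis using lim_imp_Liminf[OF False lim] by simp
  qed
qed

lemma rotation_bifun_A1: "A1 C (rotation_bifun c)"
  by (simp add: A1_def rotation_bifun_def)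

lemma rotation_bifun_A2: "A2 C (rotation_bifun c)"
  by (simp add: A2_def rotation_bifun_def algebra_simps)

lemma rotation_bifun_A3: "A3 C (rotation_bifun c)"
  unfolding A3_def
proof (intro ballI)
  fix x y z :: "nat \<Rightarrow> real"
  have "((\<lambda>t. rotation_bifun c (comb t z x) y) \<longlongrightarrow> rotation_bifun c (comb 0 z x) y) (at_right 0)"
    unfolding rotation_bifun_def comb_def by (intro tendsto_intros)
  then have "((\<lambda>t. ereal (rotation_bifun c (comb t z x) y)) \<longlongrightarrow> ereal (rotation_bifun c x y))
      (at_right 0)"
    by (simp add: comb_def)
  then show "Limsup (at_right 0) (\<lambda>t. ereal (rotation_bifun c (comb t z x) y))
      \<le> ereal (rotation_bifun c x y)"
    by (intro eq_refl lim_imp_Limsup) (rule trivial_limit_at_right_real)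
qed

lemma rotation_bifun_A4:
  assumes "convex_seq C"
  shows "A4 C (rotation_bifun c)"
  unfolding A4_def
proof (intro ballI conjI)
  fix x :: "nat \<Rightarrow> real"
  have "continuous_on C (rotation_bifun c x)"
    unfolding rotation_bifun_def
    by (intro continuous_intros continuous_on_product_coordinates[THEN continuous_on_subset]) auto
  then show "lsc_on C (rotation_bifun c x)"
    by (rule lsc_on_continuous)
  show "convex_seq_on C (rotation_bifun c x)"
    using assms by (simp add: convex_seq_on_def rotation_bifun_def comb_def algebra_simps)
qed

theorem theorem3p1:
  fixes N :: nat
  assumes "N \<ge> 2"
  shows "\<exists>(n::nat) (C :: (nat \<Rightarrow> real) set) (f :: nat \<Rightarrow> bifun) (\<alpha> :: nat \<Rightarrow> real).
           n > 0 \<and>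
           C \<noteq> {} \<and> closedin (Euclidean_space n) C \<and> convex_seq C \<and>
           (\<forall>i\<in>{1..N}. A1 C (f i) \<and> A2 C (f i) \<and> A3 C (f i) \<and> A4 C (f i)) \<and>
           (\<Inter>i\<in>{1..N}. Sol C (f i)) \<noteq> {} \<and>
           (\<forall>i\<in>{1..N}. \<alpha> i \<in> {0<..<1}) \<and>
           (\<Sum>i=1..N. \<alpha> i) = 1 \<and>
           \<not> Sol C (\<lambda>x y. \<Sum>i=1..N. \<alpha> i * f i x y) \<subseteq> (\<Inter>i\<in>{1..N}. Sol C (f i))"
proof -
  define C where "C = topspace (Euclidean_space 2)"
  define c :: "nat \<Rightarrow> real" where "c i = (if i = 1 then 1 else if i = 2 then -1 else 0)" for i
  define f where "f i = rotation_bifun (c i)" for i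
  define \<alpha> :: "nat \<Rightarrow> real" where "\<alpha> i = 1 / N" for i
  have convex: "convex_seq C"
    unfolding C_def by (rule convex_seq_Euclidean_space)
  have origin: "(\<lambda>_. 0) \<in> (\<Inter>i\<in>{1..N}. Sol C (f i))"
    by (auto simp: Sol_def C_def topspace_Euclidean_space f_def rotation_bifun_def)
  have "(\<Sum>i=1..N. c i) = (\<Sum>i\<in>{1, 2}. c i)"
    using assms by (intro sum.mono_neutral_right) (auto simp: c_def)
  then have sum_c: "(\<Sum>i=1..N. c i) = 0"
    by (simp add: c_def)
  have average: "(\<Sum>i=1..N. \<alpha> i * f i x y) = 0" for x y
  proof -
    have "(\<Sum>i=1..N. \<alpha> i * f i x y) = (\<Sum>i=1..N. c i) * ((x 0 * y 1 - x 1 * y 0) / N)"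
      unfolding sum_distrib_right by (simp add: \<alpha>_def f_def rotation_bifun_def)
    then show ?thesis by (simp only: sum_c mult_zero_left)
  qed
  \<comment> \<open>The rotation maps \<open>u\<close> to \<open>- v\<close>, so the form takes the value \<open>- 1\<close> at \<open>(u, v)\<close>.\<close>
  define u v :: "nat \<Rightarrow> real"
    where "u = (\<lambda>i. if i = 0 then 1 else 0)" and "v = (\<lambda>i. if i = 1 then -1 else 0)"
  have uv: "u \<in> C" "v \<in> C"
    by (auto simp: u_def v_def C_def topspace_Euclidean_space)
  have "f 1 u v < 0"
    by (simp add: f_def rotation_bifun_def c_def u_def v_def)
  with uv have "u \<notin> Sol C (f 1)"
    by (force simp: Sol_def)
  moreover have "u \<in> Sol C (\<lambda>x y. \<Sum>i=1..N. \<alpha> i * f i x y)"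
    using uv by (simp add: Sol_def average del: One_nat_def)
  moreover have "1 \<in> {1..N}"
    using assms by simp
  ultimately have "\<not> Sol C (\<lambda>x y. \<Sum>i=1..N. \<alpha> i * f i x y) \<subseteq> (\<Inter>i\<in>{1..N}. Sol C (f i))"
    by blast
  moreover have "closedin (Euclidean_space 2) C"
    unfolding C_def by (rule closedin_topspace)
  moreover have "\<forall>i\<in>{1..N}. A1 C (f i) \<and> A2 C (f i) \<and> A3 C (f i) \<and> A4 C (f i)"
    by (simp add: f_def rotation_bifun_A1 rotation_bifun_A2 rotation_bifun_A3
        rotation_bifun_A4 convex)
  moreover have "\<forall>i\<in>{1..N}. \<alpha> i \<in> {0<..<1}" "(\<Sum>i=1..N. \<alpha> i) = 1"
    using assms by (auto simp: \<alpha>_def)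
  moreover have "C \<noteq> {}" "(\<Inter>i\<in>{1..N}. Sol C (f i)) \<noteq> {}" "(2::nat) > 0"
    using uv(1) origin by (blast, blast, simp)
  ultimately show ?thesis
    using convex
    by (intro exI[of _ "2::nat"] exI[of _ C] exI[of _ f] exI[of _ \<alpha>] conjI) assumption+
qed

end
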